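(* In the dynamic network model described in the context, restricted to topology changes that are edge insertions, node deletions, or edge deletions, the deterministic $1$-round bandwidth complexity of $\mathsf{List}(\Gamma)$ (listing induced wedges) is $O(\log n)$, where $n$ is the current number of nodes. That is, there is a deterministic algorithm in which each node sends each neighbor $O(\log n)$ bits per round, and after the single round of communication following each topology change every induced wedge of the current graph is listed by at least one of its nodes and no set of three nodes that is not an induced wedge of the current graph is listed as one.
   Context: Dynamic network model: the network is a sequence of graphs $(G_0, G_1, \dots, G_r)$. All nodes of the initial graph $G_0$ know its complete topology. Each $G_i$ is either identical to $G_{i-1}$ or differs from it by a single topology change of an allowed type: edge insertion, edge deletion, node insertion (together with all its incident edges), or node deletion (together with all its incident edges). Each node has a unique ID of $O(\log n)$ bits, where $n$ is the current number of nodes, and knows the IDs of its current neighbors. Communication is synchronous. Each round consists of: (1) the topology change occurs, and each node learns its new neighbor list; (2) each node sends to each of its current neighbors a message of at most $B$ bits (messages to different neighbors may differ), where $B$ is the bandwidth; (3) nodes receive messages and output their lists. A deleted node sends nothing and lists nothing. An induced wedge on nodes $\{u,v,w\}$ is a path $(u,v,w)$ of length 2 (edges $\{u,v\},\{v,w\}$ present) such that the edge $\{u,w\}$ is absent; $\Gamma$ denotes the induced wedge. For a graph $H$, the problem $\mathsf{List}(H)$ requires that in each round, every induced copy of $H$ in the current graph $G_i$ be listed (the IDs of its nodes output) by at least one of its nodes, and that every listed set induce a copy of $H$ in $G_i$. The deterministic $1$-round bandwidth complexity is the minimum bandwidth $B$ for which there is a deterministic algorithm whose output at every node is correct after one round of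 communication following each topology change. *)

theory Defs
  imports Complex_Main "HOL-Library.Landau_Symbols"
begin

text \<open>
  Nodes are identified with their unique IDs, which are bit strings, so the number of bits of an
  ID is its length. Messages are bit strings too; the empty message is allowed.
\<close>

type_synonym ident = "bool list"
type_synonym message = "bool list"

record graph =
  nodes :: "ident set"
  edges :: "ident set set"

definition simple_graph :: "graph \<Rightarrow> bool" where
  "simple_graph G \<longleftrightarrow> finite (nodes G) \<and>
     (\<forall>e\<in>edges G. \<exists>u\<in>nodes G. \<exists>v\<in>nodes G. u \<noteq> v \<and> e = {u, v})"

definition nbrs :: "graph \<Rightarrow> ident \<Rightarrow> ident set" where
  "nbrs G u = {v. {u, v} \<in> edges G}"

definition induced_wedge :: "graph \<Rightarrow> ident set \<Rightarrow> bool" where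
  "induced_wedge G S \<longleftrightarrow>
     (\<exists>u v w. distinct [u, v, w] \<and> S = {u, v, w} \<and>
        {u, v} \<in> edges G \<and> {v, w} \<in> edges G \<and> {u, w} \<notin> edges G)"

definition edge_insertion :: "graph \<Rightarrow> graph \<Rightarrow> bool" where
  "edge_insertion G G' \<longleftrightarrow>
     (\<exists>u\<in>nodes G. \<exists>v\<in>nodes G. u \<noteq> v \<and> {u, v} \<notin> edges G \<and>
        G' = \<lparr>nodes = nodes G, edges = insert {u, v} (edges G)\<rparr>)"

definition edge_deletion :: "graph \<Rightarrow> graph \<Rightarrow> bool" where
  "edge_deletion G G' \<longleftrightarrow>
     (\<exists>e\<in>edges G. G' = \<lparr>nodes = nodes G, edges = edges G - {e}\<rparr>)"

definition node_deletion :: "graph \<Rightarrow> graph \<Rightarrow> bool" where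
  "node_deletion G G' \<longleftrightarrow>
     (\<exists>v\<in>nodes G. G' = \<lparr>nodes = nodes G - {v}, edges = {e \<in> edges G. v \<notin> e}\<rparr>)"

text \<open>
  The network is the sequence \<open>G 0, \<dots>, G r\<close>; the values of \<open>G\<close> beyond \<open>r\<close> are irrelevant.
  \<open>Changes\<close> is the set of allowed types of topology change, and every ID in use at a time when
  the network has \<open>n\<close> nodes has at most \<open>idbits n\<close> bits.
\<close>

definition dynamic_network ::
    "(graph \<Rightarrow> graph \<Rightarrow> bool) set \<Rightarrow> (nat \<Rightarrow> nat) \<Rightarrow> nat \<Rightarrow> (nat \<Rightarrow> graph) \<Rightarrow> bool" where
  "dynamic_network Changes idbits r G \<longleftrightarrow>
     (\<forall>i\<le>r. simple_graph (G i)) \<and>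
     (\<forall>i<r. G (Suc i) = G i \<or> (\<exists>change\<in>Changes. change (G i) (G (Suc i)))) \<and>
     (\<forall>i\<le>r. \<forall>x\<in>nodes (G i). length x \<le> idbits (card (nodes (G i))))"

text \<open>
  A view is everything a node has learned so far: its own ID, the initial graph, and for each
  completed round a partial map whose domain is the set of its neighbours in that round and
  whose values are the messages received from them. Local computation is unrestricted, so a
  deterministic algorithm is a pair of functions of the view; when sending, a node additionally
  knows its neighbour set in the graph of the current round. Giving the initial graph to every
  node is appropriate only because we never allow node insertions.
\<close>

record view =
  self :: ident
  initial :: graph
  rounds :: "(ident \<rightharpoonup> message) list"

record algorithm =
  send :: "view \<Rightarrow> ident set \<Rightarrow> ident \<Rightarrow> message"
  list_out :: "view \<Rightarrow> ident set set"

text \<open>\<open>view_at A G i x\<close> is the view of \<open>x\<close> at the end of round \<open>i\<close>; round \<open>i + 1\<close> starts with the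
  change from \<open>G i\<close> to \<open>G (i + 1)\<close>.\<close>

primrec view_at :: "algorithm \<Rightarrow> (nat \<Rightarrow> graph) \<Rightarrow> nat \<Rightarrow> ident \<Rightarrow> view" where
  "view_at A G 0 x = \<lparr>self = x, initial = G 0, rounds = []\<rparr>"
| "view_at A G (Suc i) x =
     (let received = (\<lambda>y. if y \<in> nbrs (G (Suc i)) x
                          then Some (send A (view_at A G i y) (nbrs (G (Suc i)) y) x)
                          else None)
      in (view_at A G i x)\<lparr>rounds := rounds (view_at A G i x) @ [received]\<rparr>)"

definition within_bandwidth ::
    "algorithm \<Rightarrow> (nat \<Rightarrow> nat) \<Rightarrow> nat \<Rightarrow> (nat \<Rightarrow> graph) \<Rightarrow> bool" where
  "within_bandwidth A B r G \<longleftrightarrow>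
     (\<forall>i<r. \<forall>x\<in>nodes (G (Suc i)). \<forall>y\<in>nbrs (G (Suc i)) x.
        length (send A (view_at A G i x) (nbrs (G (Suc i)) x) y)
          \<le> B (card (nodes (G (Suc i)))))"

definition listed :: "algorithm \<Rightarrow> (nat \<Rightarrow> graph) \<Rightarrow> nat \<Rightarrow> ident \<Rightarrow> ident set set" where
  "listed A G i x = (if x \<in> nodes (G i) then list_out A (view_at A G i x) else {})"

text \<open>\<open>copy G S\<close> says that the node set \<open>S\<close> induces a copy of the pattern in \<open>G\<close>.\<close>

definition solves_List ::
    "(graph \<Rightarrow> ident set \<Rightarrow> bool) \<Rightarrow> algorithm \<Rightarrow> nat \<Rightarrow> (nat \<Rightarrow> graph) \<Rightarrow> bool" where
  "solves_List copy A r G \<longleftrightarrow>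
     (\<forall>i\<in>{1..r}.
        (\<forall>S. copy (G i) S \<longrightarrow> (\<exists>x\<in>S. S \<in> listed A G i x)) \<and>
        (\<forall>x. \<forall>S\<in>listed A G i x. copy (G i) S))"

end

theory Submission
  imports Defs "HOL-Real_Asymp.Real_Asymp"
begin

text \<open>
  Every node reports the at most one change of its neighbourhood to all its neighbours. A node
  \<open>w\<close> thus knows, for each neighbour \<open>v\<close>, those edges at \<open>v\<close> that are at least as young as the
  edge \<open>vw\<close>, where all edges of the initial graph have the same age. In a wedge \<open>u, v, w\<close> the
  older of the two edges is incident to \<open>u\<close> or to \<open>w\<close>; that endpoint knows the other edge, sees
  that the two endpoints are not adjacent, and lists the wedge.
\<close>

text \<open>The first bit separates insertion from deletion; \<open>the_elem\<close> is meaningful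
  when the two sets differ in one element. Silence \<open>[]\<close> still arrives as
  \<open>Some []\<close>, so the receiver sees that the sender is a neighbour.\<close>

definition report :: "ident set \<Rightarrow> ident set \<Rightarrow> message" where
  "report N N' =
     (if N = N' then [] else if N \<subseteq> N' then True # the_elem (N' - N)
      else False # the_elem (N - N'))"

fun update :: "message \<Rightarrow> ident set \<Rightarrow> ident set" where
  "update [] K = K"
| "update (True # y) K = insert y K"
| "update (False # y) K = K - {y}"

text \<open>In the following two functions the rounds are listed with the most recent one first.\<close>

fun current_nbrs :: "graph \<Rightarrow> ident \<Rightarrow> (ident \<rightharpoonup> message) list \<Rightarrow> ident set" where
  "current_nbrs G x [] = nbrs G x"
| "current_nbrs G x (m # ms) = dom m"

text \<open>Forgetting \<open>v\<close> whenever it is not a neighbour makes the set start out empty when the edge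
  to \<open>v\<close> is inserted.\<close>

primrec known :: "graph \<Rightarrow> ident \<Rightarrow> (ident \<rightharpoonup> message) list \<Rightarrow> ident \<Rightarrow> ident set" where
  "known G x [] v = (if v \<in> nbrs G x then nbrs G v else {})"
| "known G x (m # ms) v = (case m v of None \<Rightarrow> {} | Some msg \<Rightarrow> update msg (known G x ms v))"

definition view_nbrs :: "view \<Rightarrow> ident set" where
  "view_nbrs a = current_nbrs (initial a) (self a) (rev (rounds a))"

definition view_known :: "view \<Rightarrow> ident \<Rightarrow> ident set" where
  "view_known a = known (initial a) (self a) (rev (rounds a))"

text \<open>At sending time the view \<open>a\<close> ends with the previous round, so
  \<open>view_nbrs a\<close> is the old neighbourhood and \<open>N\<close> the new one. The listing
  node is an endpoint of the wedge and \<open>v\<close> its centre.\<close>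

definition wedge_algorithm :: algorithm where
  "wedge_algorithm =
     \<lparr>send = (\<lambda>a N y. report (view_nbrs a) N),
      list_out = (\<lambda>a. {{self a, v, u} |v u. v \<in> view_nbrs a \<and> u \<in> view_known a v \<and>
                                          u \<notin> view_nbrs a \<and> u \<noteq> self a})\<rparr>"

lemma self_view_at [simp]: "self (view_at A G i x) = x"
  by (induction i) (simp_all add: Let_def)

lemma initial_view_at [simp]: "initial (view_at A G i x) = G 0"
  by (induction i) (simp_all add: Let_def)

text \<open>Holds for every algorithm, because the domain of each received map is the neighbourhood
  of that round.\<close>

lemma view_nbrs_view_at [simp]: "view_nbrs (view_at A G i x) = nbrs (G i) x"
  by (cases i) (auto simp: view_nbrs_def Let_def dom_def)

lemma view_known_0:
  "view_known (view_at A G 0 x) v = (if v \<in> nbrs (G 0) x then nbrs (G 0) v else {})"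
  by (simp add: view_known_def)

lemma view_known_Suc:
  "view_known (view_at wedge_algorithm G (Suc i) x) v =
     (if v \<in> nbrs (G (Suc i)) x
      then update (report (nbrs (G i) v) (nbrs (G (Suc i)) v))
                  (view_known (view_at wedge_algorithm G i x) v)
      else {})"
  by (simp add: view_known_def Let_def wedge_algorithm_def)

section \<open>Single changes of a neighbourhood and their reports\<close>

lemma nbrs_sym: "u \<in> nbrs G v \<longleftrightarrow> v \<in> nbrs G u"
  by (simp add: nbrs_def insert_commute)

lemma nbrs_nodes:
  assumes "simple_graph G" "u \<in> nbrs G v"
  shows "u \<in> nodes G" "v \<in> nodes G" "u \<noteq> v"
  using assms by (fastforce simp: simple_graph_def nbrs_def doubleton_eq_iff)+

definition single_change :: "'a set \<Rightarrow> 'a set \<Rightarrow> bool" where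
  "single_change N N' \<longleftrightarrow>
     N' = N \<or> (\<exists>y. y \<notin> N \<and> N' = insert y N) \<or> (\<exists>y. y \<in> N \<and> N' = N - {y})"

lemma report_insert: "y \<notin> N \<Longrightarrow> report N (insert y N) = True # y"
proof -
  assume "y \<notin> N"
  then have "insert y N - N = {y}" by auto
  with \<open>y \<notin> N\<close> show ?thesis by (auto simp: report_def)
qed

lemma report_delete: "y \<in> N \<Longrightarrow> report N (N - {y}) = False # y"
proof -
  assume "y \<in> N"
  then have "N - (N - {y}) = {y}" by auto
  with \<open>y \<in> N\<close> show ?thesis by (auto simp: report_def)
qed

lemma report_same [simp]: "report N N = []"
  by (simp add: report_def)

lemma single_change_cases:
  assumes "single_change N N'"
  obtains "N' = N" "report N N' = []"
  | y where "y \<notin> N" "N' = insert y N" "report N N' = True # y"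
  | y where "y \<in> N" "N' = N - {y}" "report N N' = False # y"
  using assms by (auto simp: single_change_def report_insert report_delete)

lemma update_report_subset:
  "single_change N N' \<Longrightarrow> K \<subseteq> N \<Longrightarrow> update (report N N') K \<subseteq> N'"
  by (erule single_change_cases) auto

lemma update_report_old:
  "single_change N N' \<Longrightarrow> u \<in> N' \<Longrightarrow> u \<in> K \<Longrightarrow> u \<in> update (report N N') K"
  by (erule single_change_cases) auto

text \<open>\<open>K\<close> is arbitrary: a newly inserted neighbour is learned even by a recipient
  that knew nothing before.\<close>

lemma update_report_new:
  "single_change N N' \<Longrightarrow> u \<in> N' \<Longrightarrow> u \<notin> N \<Longrightarrow> u \<in> update (report N N') K"
  by (erule single_change_cases) auto

lemma length_report:
  assumes "single_change N N'" "\<And>y. y \<in> N \<union> N' \<Longrightarrow> length y \<le> b"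
  shows "length (report N N') \<le> Suc b"
  using assms(1) by (rule single_change_cases) (use assms(2) in auto)

abbreviation (input) wedge_changes :: "(graph \<Rightarrow> graph \<Rightarrow> bool) set" where
  "wedge_changes \<equiv> {edge_insertion, node_deletion, edge_deletion}"

text \<open>An allowed change affects at most one edge at a surviving node. A deleted node may lose
  many neighbours at once; \<open>v \<in> nodes G'\<close> excludes it.\<close>

lemma single_change_nbrs:
  assumes "simple_graph G" "change \<in> wedge_changes" "change G G'" "v \<in> nodes G'"
  shows "single_change (nbrs G v) (nbrs G' v)"
proof -
  consider "edge_insertion G G'" | "node_deletion G G'" | "edge_deletion G G'"
    using assms by auto
  then show ?thesis
  proof cases
    case 1
    then obtain a b where ab: "a \<noteq> b" "{a, b} \<notin> edges G" "edges G' = insert {a, b} (edges G)"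
      by (auto simp: edge_insertion_def)
    then have "nbrs G' v =
        (if v = a then insert b (nbrs G v) else if v = b then insert a (nbrs G v) else nbrs G v)"
      by (auto simp: nbrs_def doubleton_eq_iff)
    moreover have "b \<notin> nbrs G a" "a \<notin> nbrs G b"
      using ab by (auto simp: nbrs_def insert_commute)
    ultimately show ?thesis
      by (auto simp: single_change_def)
  next
    case 2
    then obtain z where "nodes G' = nodes G - {z}" "edges G' = {e \<in> edges G. z \<notin> e}"
      by (auto simp: node_deletion_def)
    with assms(4) have "nbrs G' v = nbrs G v - {z}"
      by (auto simp: nbrs_def)
    then show ?thesis
      by (auto simp: single_change_def)
  next
    case 3
    then obtain e where e: "e \<in> edges G" "edges G' = edges G - {e}"
      by (auto simp: edge_deletion_def)
    with assms(1) obtain a b where ab: "a \<noteq> b" "e = {a, b}"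
      by (auto simp: simple_graph_def)
    with e have "nbrs G' v =
        (if v = a then nbrs G v - {b} else if v = b then nbrs G v - {a} else nbrs G v)"
      by (auto simp: nbrs_def doubleton_eq_iff)
    moreover have "b \<in> nbrs G a" "a \<in> nbrs G b"
      using e ab by (auto simp: nbrs_def insert_commute)
    ultimately show ?thesis
      by (auto simp: single_change_def)
  qed
qed

lemma card_nodes_change:
  assumes "simple_graph G" "change \<in> wedge_changes" "change G G'"
  shows "card (nodes G) = card (nodes G') \<or> card (nodes G) = Suc (card (nodes G'))"
proof -
  have "finite (nodes G)"
    using assms(1) by (simp add: simple_graph_def)
  then show ?thesis
    using assms(2,3)
    by (auto simp: edge_insertion_def edge_deletion_def node_deletion_def card_Suc_Diff1
        simp del: card_Diff_insert)
qed

section \<open>Correctness and bandwidth on a fixed network\<close>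

locale wedge_network =
  fixes idbits :: "nat \<Rightarrow> nat" and r :: nat and G :: "nat \<Rightarrow> graph"
  assumes network: "dynamic_network wedge_changes idbits r G"
begin

lemma simple: "i \<le> r \<Longrightarrow> simple_graph (G i)"
  using network by (simp add: dynamic_network_def)

lemma length_ident: "i \<le> r \<Longrightarrow> x \<in> nodes (G i) \<Longrightarrow> length x \<le> idbits (card (nodes (G i)))"
  using network by (simp add: dynamic_network_def)

lemma step:
  assumes "i < r"
  obtains "G (Suc i) = G i" | change where "change \<in> wedge_changes" "change (G i) (G (Suc i))"
  using network assms unfolding dynamic_network_def by blast

lemma single_change_step:
  assumes "i < r" "v \<in> nodes (G (Suc i))"
  shows "single_change (nbrs (G i) v) (nbrs (G (Suc i)) v)"
  using assms(1)
proof (cases rule: step)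
  case 1
  then show ?thesis by (simp add: single_change_def)
next
  case 2
  then show ?thesis using single_change_nbrs simple assms by simp
qed

lemma card_nodes_step:
  assumes "i < r"
  shows "card (nodes (G i)) = card (nodes (G (Suc i))) \<or>
    card (nodes (G i)) = Suc (card (nodes (G (Suc i))))"
  using assms
proof (cases rule: step)
  case 2
  then show ?thesis using card_nodes_change simple assms by simp
qed simp

abbreviation knows :: "nat \<Rightarrow> ident \<Rightarrow> ident \<Rightarrow> ident set" where
  "knows i x \<equiv> view_known (view_at wedge_algorithm G i x)"

text \<open>A report carries a subset of the old neighbourhood of \<open>v\<close> to a subset of
  the new one, and nothing is stored for non-neighbours, so a deleted \<open>v\<close> leaves no
  stale knowledge.\<close>

lemma knows_sound: "i \<le> r \<Longrightarrow> knows i w v \<subseteq> nbrs (G i) v"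
proof (induction i)
  case 0
  then show ?case by (simp only: view_known_0) simp
next
  case (Suc i)
  show ?case
  proof (cases "v \<in> nbrs (G (Suc i)) w")
    case True
    then have "v \<in> nodes (G (Suc i))"
      using nbrs_nodes simple Suc.prems by blast
    then show ?thesis
      using Suc single_change_step True update_report_subset
      by (simp add: view_known_Suc del: view_at.simps)
  qed (simp add: view_known_Suc del: view_at.simps)
qed

text \<open>The endpoint whose edge to \<open>v\<close> is at least as old knows the other one:
  initially both do, and the knowledge persists as long as both edges last.\<close>

lemma knows_complete:
  "i \<le> r \<Longrightarrow> u \<in> nbrs (G i) v \<Longrightarrow> w \<in> nbrs (G i) v \<Longrightarrow> u \<in> knows i w v \<or> w \<in> knows i u v"
proof (induction i)
  case 0
  then show ?case by (simp only: view_known_0) (simp add: nbrs_sym[of v])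
next
  case (Suc i)
  let ?N = "nbrs (G i) v" and ?N' = "nbrs (G (Suc i)) v"
  have change: "single_change ?N ?N'"
    using Suc.prems nbrs_nodes simple single_change_step by (meson Suc_le_lessD)
  have knows_Suc: "knows (Suc i) x v = update (report ?N ?N') (knows i x v)" if "x \<in> ?N'" for x
    using that by (simp add: view_known_Suc nbrs_sym[of v] del: view_at.simps)
  show ?case
  proof (cases "u \<in> ?N \<and> w \<in> ?N")
    case True
    with Suc have "u \<in> knows i w v \<or> w \<in> knows i u v" by simp
    then show ?thesis
      using Suc.prems change knows_Suc update_report_old by metis
  next
    \<comment> \<open>One of the two edges is new, so \<open>v\<close> has just reported its far end
      to the other endpoint.\<close>
    case False
    then show ?thesis
      using Suc.prems change knows_Suc update_report_new by metis
  qed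
qed

lemma within_bandwidth_wedge:
  "within_bandwidth wedge_algorithm (\<lambda>n. Suc (idbits n + idbits (Suc n))) r G"
  unfolding within_bandwidth_def
proof (intro allI impI ballI)
  fix i x y
  assume i: "i < r" and x: "x \<in> nodes (G (Suc i))"
  let ?n = "card (nodes (G (Suc i)))"
  have "length z \<le> idbits ?n + idbits (Suc ?n)" if "z \<in> nbrs (G i) x \<union> nbrs (G (Suc i)) x" for z
  proof -
    \<comment> \<open>A reported ID may belong to a node deleted in this very round, so it is
      bounded through \<open>G i\<close>. As \<open>idbits\<close> is not assumed monotone, its
      values at both possible node counts are added.\<close>
    have "z \<in> nodes (G i) \<or> z \<in> nodes (G (Suc i))"
      using that i nbrs_nodes simple by (meson UnE Suc_leI less_imp_le)
    then have "length z \<le> idbits (card (nodes (G i))) \<or> length z \<le> idbits ?n"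
      using length_ident i by (meson Suc_leI less_imp_le)
    then show ?thesis
      using card_nodes_step[OF i] by auto
  qed
  then show "length (send wedge_algorithm (view_at wedge_algorithm G i x) (nbrs (G (Suc i)) x) y)
      \<le> Suc (idbits ?n + idbits (Suc ?n))"
    using length_report[OF single_change_step[OF i x]] by (simp add: wedge_algorithm_def)
qed

lemma listed_wedge:
  "listed wedge_algorithm G i x =
     (if x \<in> nodes (G i)
      then {{x, v, u} |v u. v \<in> nbrs (G i) x \<and> u \<in> knows i x v \<and> u \<notin> nbrs (G i) x \<and> u \<noteq> x}
      else {})"
proof -
  have "list_out wedge_algorithm a = {{self a, v, u} |v u. v \<in> view_nbrs a \<and> u \<in> view_known a v \<and>
      u \<notin> view_nbrs a \<and> u \<noteq> self a}" for a
    by (simp add: wedge_algorithm_def)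
  then show ?thesis by (simp add: listed_def)
qed

text \<open>The absent edge is certain because \<open>x\<close> sees its own current neighbours; the
  edge far from \<open>x\<close> is present by \<open>knows_sound\<close>.\<close>

lemma listed_sound:
  assumes "i \<le> r" "S \<in> listed wedge_algorithm G i x"
  shows "induced_wedge (G i) S"
proof -
  obtain v u where S: "S = {x, v, u}" "v \<in> nbrs (G i) x" "u \<in> knows i x v"
      "u \<notin> nbrs (G i) x" "u \<noteq> x"
    using assms(2) by (auto simp: listed_wedge split: if_splits)
  have "u \<in> nbrs (G i) v"
    using S(3) knows_sound assms(1) by blast
  moreover from this have "u \<noteq> v" "v \<noteq> x"
    using nbrs_nodes(3) simple[OF assms(1)] S(2) by metis+
  ultimately show ?thesis
    unfolding induced_wedge_def using S
    by (intro exI[of _ x] exI[of _ v] exI[of _ u]) (auto simp: nbrs_def)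
qed

lemma listed_complete:
  assumes "i \<le> r" "induced_wedge (G i) S"
  shows "\<exists>x\<in>S. S \<in> listed wedge_algorithm G i x"
proof -
  obtain u v w where S: "u \<noteq> w" "S = {u, v, w}"
      "{u, v} \<in> edges (G i)" "{v, w} \<in> edges (G i)" "{u, w} \<notin> edges (G i)"
    using assms(2) by (auto simp: induced_wedge_def)
  then have nbrs: "u \<in> nbrs (G i) v" "w \<in> nbrs (G i) v" "w \<notin> nbrs (G i) u"
    by (auto simp: nbrs_def insert_commute)
  \<comment> \<open>Stated for a generic endpoint \<open>x\<close>, since either end may be the one
    that lists.\<close>
  have listed: "{x, v, y} \<in> listed wedge_algorithm G i x"
    if "x \<in> nbrs (G i) v" "y \<in> knows i x v" "y \<notin> nbrs (G i) x" "y \<noteq> x" for x y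
  proof -
    have "x \<in> nodes (G i)" "v \<in> nbrs (G i) x"
      using that(1) nbrs_nodes(1) simple assms(1) nbrs_sym by blast+
    with that show ?thesis
      unfolding listed_wedge by auto
  qed
  from knows_complete[OF assms(1) nbrs(1,2)] show ?thesis
  proof
    assume "u \<in> knows i w v"
    then have "{w, v, u} \<in> listed wedge_algorithm G i w"
      using listed nbrs nbrs_sym S(1) by blast
    moreover have "S = {w, v, u}" using S(2) by auto
    ultimately show ?thesis by blast
  next
    assume "w \<in> knows i u v"
    then show ?thesis
      using listed nbrs S(1,2) by blast
  qed
qed

lemma solves_List_wedge: "solves_List induced_wedge wedge_algorithm r G"
  unfolding solves_List_def using listed_sound listed_complete by simp

end

text \<open>The summand for \<open>Suc n\<close> accounts for reports of a node that has just been deleted: its ID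
  is only bounded in terms of the previous number of nodes.\<close>

lemma bandwidth_bigo:
  fixes f :: "nat \<Rightarrow> nat"
  assumes "(\<lambda>n. real (f n)) \<in> O(\<lambda>n. log 2 (real n))"
  shows "(\<lambda>n. real (Suc (f n + f (Suc n)))) \<in> O(\<lambda>n. log 2 (real n))"
proof -
  have "(\<lambda>n. real (f (Suc n))) \<in> O(\<lambda>n. log 2 (real (Suc n)))"
    using assms filterlim_Suc by (rule landau_o.big.compose)
  also have "(\<lambda>n. log 2 (real (Suc n))) \<in> O(\<lambda>n. log 2 (real n))"
    by real_asymp
  finally have "(\<lambda>n. real (f (Suc n))) \<in> O(\<lambda>n. log 2 (real n))" .
  \<comment> \<open>Absorbs the tag bit of a report.\<close>
  moreover have "(\<lambda>n. 1) \<in> O(\<lambda>n. log 2 (real n))"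
    by real_asymp
  ultimately have "(\<lambda>n. 1 + (real (f n) + real (f (Suc n)))) \<in> O(\<lambda>n. log 2 (real n))"
    using assms by (intro sum_in_bigo)
  then show ?thesis by simp
qed

theorem theorem2:
  fixes idbits :: "nat \<Rightarrow> nat"
  assumes "(\<lambda>n. real (idbits n)) \<in> O(\<lambda>n. log 2 (real n))"
  shows "\<exists>(A :: algorithm) (B :: nat \<Rightarrow> nat).
           (\<lambda>n. real (B n)) \<in> O(\<lambda>n. log 2 (real n)) \<and>
           (\<forall>r G. dynamic_network {edge_insertion, node_deletion, edge_deletion} idbits r G \<longrightarrow>
              within_bandwidth A B r G \<and> solves_List induced_wedge A r G)"
proof (intro exI conjI allI impI)
  \<comment> \<open>This fixes the witness for \<open>B\<close>, which, like the algorithm, may not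
    depend on \<open>r\<close> and \<open>G\<close>.\<close>
  show "(\<lambda>n. real (Suc (idbits n + idbits (Suc n)))) \<in> O(\<lambda>n. log 2 (real n))"
    using assms by (rule bandwidth_bigo)
next
  fix r G
  assume "dynamic_network wedge_changes idbits r G"
  then interpret wedge_network idbits r G
    by unfold_locales
  show "within_bandwidth wedge_algorithm (\<lambda>n. Suc (idbits n + idbits (Suc n))) r G"
    by (rule within_bandwidth_wedge)
  show "solves_List induced_wedge wedge_algorithm r G"
    by (rule solves_List_wedge)
qed

end
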